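(* Let $X$ and $Y$ be Banach spaces. Then $$\operatorname{RSE}(X,Y)=\operatorname{NA}(X,Y)\cap\operatorname{UQNA}(X,Y).$$
   Context: Banach spaces are over $\mathbb{K}$, where $\mathbb{K}=\mathbb{R}$ or $\mathbb{C}$, and are nonzero. $\mathbb{T}=\{\theta\in\mathbb{K}\colon|\theta|=1\}$; $B_X$, $S_X$ are the closed unit ball and unit sphere; $\mathcal{L}(X,Y)$ is the space of bounded linear operators with the operator norm. For $T\in\mathcal{L}(X,Y)$: $T\in\operatorname{NA}(X,Y)$ if $\|T\|=\max\{\|Tx\|\colon x\in B_X\}$ (the maximum is attained); $T\in\operatorname{UQNA}(X,Y)$ (uniquely quasi norm-attaining) if there exists $y_0\in\|T\|S_Y$ such that whenever $(x_n)\subseteq B_X$ satisfies $\|Tx_n\|\to\|T\|$, there are a subsequence $(x_{\sigma(n)})$ and $\theta\in\mathbb{T}$ with $Tx_{\sigma(n)}\to\theta y_0$ in norm; $T\in\operatorname{RSE}(X,Y)$ (range strongly exposing) if there exists $x_0\in S_X$ such that whenever $(x_n)\subseteq B_X$ satisfies $\|Tx_n\|\to\|T\|$, there are a subsequence $(x_{\sigma(n)})$ and $\theta\in\mathbb{T}$ with $Tx_{\sigma(n)}\to\theta Tx_0$ in norm. *)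

theory Defs
  imports "HOL-Analysis.Analysis"
begin

text \<open>
  A nonzero Banach space over a normed field \<open>'k\<close>, used below with \<open>'k\<close> being \<^typ>\<open>real\<close> or
  \<^typ>\<open>complex\<close>. The class \<^class>\<open>banach\<close> only supplies a real scalar multiplication, so the scalar
  multiplication by \<open>'k\<close> is a parameter that has to extend it. For \<^typ>\<open>real\<close> the axiom
  \<open>scale_of_real\<close> forces \<open>scale\<close> to be the one of the class.
\<close>

locale banach_space_over = vector_space scale
  for scale :: "'k::real_normed_field \<Rightarrow> 'a::banach \<Rightarrow> 'a" +
  assumes scale_of_real: "scale (of_real r) x = r *\<^sub>R x"
    and norm_scale: "norm (scale c x) = norm c * norm x"
    and nonzero: "\<exists>x::'a. x \<noteq> 0"

text \<open>
  Elements of the type of bounded real-linear maps that are linear over \<open>'k\<close>. The operator norm is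
  the norm of that type, since it depends on the unit ball of the domain only.
\<close>

definition bounded_ops ::
  "('k::real_normed_field \<Rightarrow> 'a::banach \<Rightarrow> 'a) \<Rightarrow> ('k \<Rightarrow> 'b::banach \<Rightarrow> 'b) \<Rightarrow> ('a \<Rightarrow>\<^sub>L 'b) set"
  where "bounded_ops sX sY = {T. Vector_Spaces.linear sX sY (blinfun_apply T)}"

definition NA ::
  "('k::real_normed_field \<Rightarrow> 'a::banach \<Rightarrow> 'a) \<Rightarrow> ('k \<Rightarrow> 'b::banach \<Rightarrow> 'b) \<Rightarrow> ('a \<Rightarrow>\<^sub>L 'b) set"
  where "NA sX sY = {T \<in> bounded_ops sX sY.
    norm T \<in> {norm (blinfun_apply T x) | x. x \<in> cball 0 1} \<and>
    (\<forall>x\<in>cball 0 1. norm (blinfun_apply T x) \<le> norm T)}"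

definition UQNA ::
  "('k::real_normed_field \<Rightarrow> 'a::banach \<Rightarrow> 'a) \<Rightarrow> ('k \<Rightarrow> 'b::banach \<Rightarrow> 'b) \<Rightarrow> ('a \<Rightarrow>\<^sub>L 'b) set"
  where "UQNA sX sY = {T \<in> bounded_ops sX sY.
    \<exists>y0 \<in> (*\<^sub>R) (norm T) ` sphere 0 1.
      \<forall>x :: nat \<Rightarrow> 'a. range x \<subseteq> cball 0 1 \<and> (\<lambda>n. norm (blinfun_apply T (x n))) \<longlonglongrightarrow> norm T \<longrightarrow>
        (\<exists>(\<sigma> :: nat \<Rightarrow> nat) (\<theta> :: 'k). strict_mono \<sigma> \<and> norm \<theta> = 1 \<and>
          (\<lambda>n. blinfun_apply T (x (\<sigma> n))) \<longlonglongrightarrow> sY \<theta> y0)}"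

definition RSE ::
  "('k::real_normed_field \<Rightarrow> 'a::banach \<Rightarrow> 'a) \<Rightarrow> ('k \<Rightarrow> 'b::banach \<Rightarrow> 'b) \<Rightarrow> ('a \<Rightarrow>\<^sub>L 'b) set"
  where "RSE sX sY = {T \<in> bounded_ops sX sY.
    \<exists>x0 \<in> sphere 0 1.
      \<forall>x :: nat \<Rightarrow> 'a. range x \<subseteq> cball 0 1 \<and> (\<lambda>n. norm (blinfun_apply T (x n))) \<longlonglongrightarrow> norm T \<longrightarrow>
        (\<exists>(\<sigma> :: nat \<Rightarrow> nat) (\<theta> :: 'k). strict_mono \<sigma> \<and> norm \<theta> = 1 \<and>
          (\<lambda>n. blinfun_apply T (x (\<sigma> n))) \<longlonglongrightarrow> sY \<theta> (blinfun_apply T x0))}"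

end

theory Submission
  imports Defs
begin

text \<open>
  Fix an operator \<open>T\<close>. Two observations make the two descriptions interchangeable.

  If \<open>T\<close> is range strongly exposing with witness \<open>x\<^sub>0\<close>, apply the defining property to some
  maximizing sequence (\<open>maximizing_sequence_exists\<close>): along a subsequence the norms
  of the images tend both to \<open>norm T\<close> and to the norm of a unimodular multiple of \<open>T x\<^sub>0\<close>. Hence the
  norm is attained at \<open>x\<^sub>0\<close>, and \<open>y\<^sub>0 = T x\<^sub>0\<close> is a witness for the unique quasi attainment.

  Conversely, if \<open>T\<close> is uniquely quasi norm-attaining with witness \<open>y\<^sub>0\<close> and attains its norm at a
  unit vector \<open>x\<^sub>0\<close>, the constant sequence \<open>x\<^sub>0\<close> is maximizing, which forces \<open>T x\<^sub>0\<close> to be a unimodular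
  multiple of \<open>y\<^sub>0\<close>. The condition on subsequential limits is invariant under unimodular multiples
  (\<open>clusters_at_rotation\<close>), so \<open>y\<^sub>0\<close> may be replaced by \<open>T x\<^sub>0\<close>.

  For \<open>T = 0\<close> the required unit vectors come from the spaces being nonzero. Dividing by
  unimodular scalars and multiplicativity of the norm make sense over every real normed field, so the
  real and complex cases are instances of one statement (\<open>RSE_eq_NA_Int_UQNA\<close>).
\<close>

text \<open>
  The condition on maximizing sequences shared by the two classes: they differ only in where the
  point \<open>y\<close> is taken from.
\<close>

definition maximizers_cluster_at ::
  "('k::real_normed_field \<Rightarrow> 'b::banach \<Rightarrow> 'b) \<Rightarrow> ('a::banach \<Rightarrow>\<^sub>L 'b) \<Rightarrow> 'b \<Rightarrow> bool"
  where "maximizers_cluster_at sY T y \<longleftrightarrow>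
      (\<forall>x :: nat \<Rightarrow> 'a. range x \<subseteq> cball 0 1 \<and> (\<lambda>n. norm (blinfun_apply T (x n))) \<longlonglongrightarrow> norm T \<longrightarrow>
        (\<exists>(\<sigma> :: nat \<Rightarrow> nat) (\<theta> :: 'k). strict_mono \<sigma> \<and> norm \<theta> = 1 \<and>
          (\<lambda>n. blinfun_apply T (x (\<sigma> n))) \<longlonglongrightarrow> sY \<theta> y))"

lemma RSE_iff:
  "T \<in> RSE sX sY \<longleftrightarrow>
     T \<in> bounded_ops sX sY \<and> (\<exists>x0\<in>sphere 0 1. maximizers_cluster_at sY T (blinfun_apply T x0))"
  by (simp add: RSE_def maximizers_cluster_at_def)

lemma UQNA_iff:
  "T \<in> UQNA sX sY \<longleftrightarrow>
     T \<in> bounded_ops sX sY \<and> (\<exists>y0\<in>(*\<^sub>R) (norm T) ` sphere 0 1. maximizers_cluster_at sY T y0)"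
  by (simp add: UQNA_def maximizers_cluster_at_def)

lemma norm_blinfun_le_on_ball:
  fixes T :: "'a::real_normed_vector \<Rightarrow>\<^sub>L 'b::real_normed_vector"
  assumes "x \<in> cball 0 1"
  shows "norm (blinfun_apply T x) \<le> norm T"
  using norm_blinfun[of T x] mult_left_le[of "norm x" "norm T"] assms by simp

lemma norm_blinfun_bound_on_ball:
  fixes T :: "'a::real_normed_vector \<Rightarrow>\<^sub>L 'b::real_normed_vector"
  assumes bound: "\<And>x. x \<in> cball 0 1 \<Longrightarrow> norm (blinfun_apply T x) \<le> b"
  shows "norm T \<le> b"
proof (rule norm_blinfun_bound)
  show "0 \<le> b" using bound[of 0] by simp
  fix x
  show "norm (blinfun_apply T x) \<le> b * norm x"
  proof (cases "x = 0")
    case False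
    then have "norm (blinfun_apply T (x /\<^sub>R norm x)) \<le> b" by (intro bound) simp
    then show ?thesis using False by (simp add: blinfun.scaleR_right field_simps)
  qed simp
qed

lemma maximizing_sequence_exists:
  fixes T :: "'a::real_normed_vector \<Rightarrow>\<^sub>L 'b::real_normed_vector"
  obtains x :: "nat \<Rightarrow> 'a"
  where "range x \<subseteq> cball 0 1" "(\<lambda>n. norm (blinfun_apply T (x n))) \<longlonglongrightarrow> norm T"
proof -
  have "\<exists>x\<in>cball 0 1. norm T - 1 / real (Suc n) \<le> norm (blinfun_apply T x)" for n
  proof (rule ccontr)
    assume "\<not> ?thesis"
    then have "norm T \<le> norm T - 1 / real (Suc n)"
      by (intro norm_blinfun_bound_on_ball) (meson linear)
    then show False by simp
  qed
  then obtain x where ball: "\<And>n. x n \<in> cball 0 1"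
    and near: "\<And>n. norm T - 1 / real (Suc n) \<le> norm (blinfun_apply T (x n))"
    by metis
  have "(\<lambda>n. norm T - 1 / real (Suc n)) \<longlonglongrightarrow> norm T"
    using tendsto_diff[OF tendsto_const LIMSEQ_inverse_real_of_nat]
    by (simp add: inverse_eq_divide)
  then have "(\<lambda>n. norm (blinfun_apply T (x n))) \<longlonglongrightarrow> norm T"
    by (rule tendsto_sandwich[rotated 2, OF _ tendsto_const])
       (intro always_eventually allI near norm_blinfun_le_on_ball ball)+
  with ball that show thesis by blast
qed

lemma (in banach_space_over) unit_vector_exists: "\<exists>u::'a. norm u = 1"
proof -
  obtain z :: 'a where "z \<noteq> 0" using nonzero by blast
  then have "norm (z /\<^sub>R norm z) = 1" by simp
  then show ?thesis ..
qed

text \<open>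
  A nonzero operator cannot attain its norm in the interior of the ball, and the zero operator attains
  it everywhere, in particular at some unit vector of the nonzero space, so the ball may be replaced by the sphere.
\<close>

lemma NA_iff_attained_on_sphere:
  assumes "banach_space_over sX"
  shows "T \<in> NA sX sY \<longleftrightarrow>
     T \<in> bounded_ops sX sY \<and> (\<exists>x0\<in>sphere 0 1. norm (blinfun_apply T x0) = norm T)"
proof -
  have "\<exists>x0\<in>sphere 0 1. norm (blinfun_apply T x0) = norm T"
    if x: "x \<in> cball 0 1" and att: "norm (blinfun_apply T x) = norm T" for x
  proof (cases "T = 0")
    case True
    then show ?thesis using banach_space_over.unit_vector_exists[OF assms] by auto
  next
    case False
    then have "1 \<le> norm x" using norm_blinfun[of T x] att by simp
    with x att show ?thesis by (intro bexI[of _ x]) auto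
  qed
  then have "norm T \<in> {norm (blinfun_apply T x) | x. x \<in> cball 0 1} \<longleftrightarrow>
      (\<exists>x0\<in>sphere 0 1. norm (blinfun_apply T x0) = norm T)"
    using sphere_cball[of 0 1] by (smt (verit, best) mem_Collect_eq subsetD)
  then show ?thesis
    unfolding NA_def using norm_blinfun_le_on_ball[of _ T] by blast
qed

lemma (in banach_space_over) mem_scaled_sphere:
  assumes "norm y = r"
  shows "(y::'a) \<in> (*\<^sub>R) r ` sphere 0 1"
proof (cases "y = 0")
  case True
  then show ?thesis using unit_vector_exists assms by force
next
  case False
  then show ?thesis using assms by (intro image_eqI[of _ _ "y /\<^sub>R r"]) auto
qed

lemma norm_cluster_point:
  assumes "banach_space_over sY" and clusters: "maximizers_cluster_at sY T y"
  shows "norm y = norm T"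
proof -
  interpret banach_space_over sY by fact
  obtain x where x: "range x \<subseteq> cball 0 1" "(\<lambda>n. norm (blinfun_apply T (x n))) \<longlonglongrightarrow> norm T"
    by (rule maximizing_sequence_exists)
  then obtain \<sigma> \<theta> where \<sigma>: "strict_mono \<sigma>" and \<theta>: "norm \<theta> = 1"
    and lim: "(\<lambda>n. blinfun_apply T (x (\<sigma> n))) \<longlonglongrightarrow> sY \<theta> y"
    using clusters unfolding maximizers_cluster_at_def by blast
  have "(\<lambda>n. norm (blinfun_apply T (x (\<sigma> n)))) \<longlonglongrightarrow> norm T"
    using LIMSEQ_subseq_LIMSEQ[OF x(2) \<sigma>] by (simp add: o_def)
  moreover have "(\<lambda>n. norm (blinfun_apply T (x (\<sigma> n)))) \<longlonglongrightarrow> norm y"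
    using tendsto_norm[OF lim] \<theta> by (simp add: norm_scale)
  ultimately show ?thesis by (rule LIMSEQ_unique[symmetric])
qed

text \<open>
  A constant sequence has only its own value as a limit of subsequences, so every point where the
  norm is attained has its image on the orbit of \<open>y\<close> under the unimodular scalars.
\<close>

lemma attained_value_in_orbit:
  assumes "maximizers_cluster_at sY T y" "x0 \<in> sphere 0 1" "norm (blinfun_apply T x0) = norm T"
  obtains \<theta> where "norm \<theta> = 1" "blinfun_apply T x0 = sY \<theta> y"
proof -
  have "range (\<lambda>_::nat. x0) \<subseteq> cball 0 1" "(\<lambda>_::nat. norm (blinfun_apply T x0)) \<longlonglongrightarrow> norm T"
    using assms by auto
  then obtain \<theta> where "norm \<theta> = 1" "(\<lambda>_::nat. blinfun_apply T x0) \<longlonglongrightarrow> sY \<theta> y"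
    using assms(1)[unfolded maximizers_cluster_at_def, rule_format, of "\<lambda>_. x0"] by auto
  then show thesis using that LIMSEQ_unique[OF tendsto_const] by blast
qed

lemma clusters_at_rotation:
  fixes sY :: "'k::real_normed_field \<Rightarrow> 'b::banach \<Rightarrow> 'b" and T :: "'a::banach \<Rightarrow>\<^sub>L 'b"
  assumes "banach_space_over sY" and clusters: "maximizers_cluster_at sY T y" and \<theta>: "norm \<theta> = 1"
  shows "maximizers_cluster_at sY T (sY \<theta> y)"
  unfolding maximizers_cluster_at_def
proof (intro allI impI)
  interpret banach_space_over sY by fact
  fix x :: "nat \<Rightarrow> 'a"
  assume "range x \<subseteq> cball 0 1 \<and> (\<lambda>n. norm (blinfun_apply T (x n))) \<longlonglongrightarrow> norm T"
  then obtain \<sigma> \<eta> where "strict_mono \<sigma>" "norm \<eta> = 1"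
    and lim: "(\<lambda>n. blinfun_apply T (x (\<sigma> n))) \<longlonglongrightarrow> sY \<eta> y"
    using clusters unfolding maximizers_cluster_at_def by blast
  moreover have "sY \<eta> y = sY (\<eta> / \<theta>) (sY \<theta> y)" using \<theta> by auto
  moreover have "norm (\<eta> / \<theta>) = 1" using \<theta> \<open>norm \<eta> = 1\<close> by (simp add: norm_divide)
  ultimately show "\<exists>\<sigma> \<theta>'. strict_mono \<sigma> \<and> norm \<theta>' = 1 \<and>
      (\<lambda>n. blinfun_apply T (x (\<sigma> n))) \<longlonglongrightarrow> sY \<theta>' (sY \<theta> y)"
    by metis
qed

theorem RSE_eq_NA_Int_UQNA:
  fixes sX :: "'k::real_normed_field \<Rightarrow> 'a::banach \<Rightarrow> 'a" and sY :: "'k \<Rightarrow> 'b::banach \<Rightarrow> 'b"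
  assumes X: "banach_space_over sX" and Y: "banach_space_over sY"
  shows "RSE sX sY = NA sX sY \<inter> UQNA sX sY"
proof (intro equalityI subsetI)
  fix T assume "T \<in> RSE sX sY"
  then obtain x0 where T: "T \<in> bounded_ops sX sY" and x0: "x0 \<in> sphere 0 1"
    and clusters: "maximizers_cluster_at sY T (blinfun_apply T x0)"
    by (auto simp: RSE_iff)
  have att: "norm (blinfun_apply T x0) = norm T"
    using norm_cluster_point[OF Y clusters] .
  have "T \<in> NA sX sY"
    using T x0 att by (auto simp: NA_iff_attained_on_sphere[OF X])
  moreover have "T \<in> UQNA sX sY"
    using T clusters banach_space_over.mem_scaled_sphere[OF Y att] by (auto simp: UQNA_iff)
  ultimately show "T \<in> NA sX sY \<inter> UQNA sX sY" ..
next
  fix T assume "T \<in> NA sX sY \<inter> UQNA sX sY"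
  then obtain x0 y0 where T: "T \<in> bounded_ops sX sY" and x0: "x0 \<in> sphere 0 1"
    and att: "norm (blinfun_apply T x0) = norm T" and clusters: "maximizers_cluster_at sY T y0"
    unfolding Int_iff NA_iff_attained_on_sphere[OF X] UQNA_iff by blast
  obtain \<theta> where "norm \<theta> = 1" "blinfun_apply T x0 = sY \<theta> y0"
    by (rule attained_value_in_orbit[OF clusters x0 att])
  then have "maximizers_cluster_at sY T (blinfun_apply T x0)"
    using clusters_at_rotation[OF Y clusters] by simp
  with T x0 show "T \<in> RSE sX sY" by (auto simp: RSE_iff)
qed

theorem proposition2p3:
  shows "(\<forall>(sX :: real \<Rightarrow> 'a::banach \<Rightarrow> 'a) (sY :: real \<Rightarrow> 'b::banach \<Rightarrow> 'b).
            banach_space_over sX \<and> banach_space_over sY \<longrightarrow>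
            RSE sX sY = NA sX sY \<inter> UQNA sX sY) \<and>
         (\<forall>(sX :: complex \<Rightarrow> 'a \<Rightarrow> 'a) (sY :: complex \<Rightarrow> 'b \<Rightarrow> 'b).
            banach_space_over sX \<and> banach_space_over sY \<longrightarrow>
            RSE sX sY = NA sX sY \<inter> UQNA sX sY)"
  by (intro conjI allI impI; elim conjE; rule RSE_eq_NA_Int_UQNA)

end
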